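(* Let $d\ge 1$ and $m\ge 1$ be integers, let $s,t\in\mathbb{R}$ with $t<s$, and let $w_1,\ldots,w_m\in\mathbb{R}^d$ be vectors such that $\langle w_i,w_i\rangle=s$ for all $i$ and $\langle w_i,w_j\rangle=t$ for all $i\ne j$. Then $m\le d+1$; moreover, if $m=d+1$, then $t=-s/d$.
   Context: Here $\langle\cdot,\cdot\rangle$ denotes the standard Euclidean inner product on $\mathbb{R}^d$. *)

theory Defs
  imports "HOL-Analysis.Analysis"
begin

end

theory Submission imports Defs begin

text \<open>Pairing a linear dependency \<open>\<Sum>x. c x *\<^sub>R x = 0\<close> with each vector shows that all
  coefficients \<open>c x\<close> are equal and nonzero, which forces \<open>s + (n - 1) t = 0\<close> for \<open>n\<close> vectors.
  Any \<open>d + 1\<close> vectors in dimension \<open>d\<close> are dependent, so \<open>n = d + 1\<close> yields \<open>t = - s / d\<close>;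
  if there were \<open>d + 2\<close> vectors, the relations for \<open>n = d + 1\<close> and \<open>n = d + 2\<close> together would
  give \<open>s = t = 0\<close>.\<close>

lemma dependent_equiangular:
  fixes S :: "'a::real_inner set" and s t :: real
  assumes "finite S" and "dependent S" and "t < s"
    and diag: "\<And>x. x \<in> S \<Longrightarrow> x \<bullet> x = s"
    and off: "\<And>x y. x \<in> S \<Longrightarrow> y \<in> S \<Longrightarrow> x \<noteq> y \<Longrightarrow> x \<bullet> y = t"
  shows "s + (real (card S) - 1) * t = 0"
proof -
  obtain c where c: "\<exists>x\<in>S. c x \<noteq> 0" "(\<Sum>x\<in>S. c x *\<^sub>R x) = 0"
    using assms(1,2) by (auto simp: dependent_finite)
  define C where "C = sum c S"
  have eq: "(s - t) * c y + t * C = 0" if "y \<in> S" for y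
  proof -
    have "0 = (\<Sum>x\<in>S. c x *\<^sub>R x) \<bullet> y"
      using c by simp
    also have "\<dots> = (\<Sum>x\<in>S. c x * (x \<bullet> y))"
      by (simp add: inner_sum_left)
    \<comment> \<open>The Gram matrix is the constant \<open>t\<close> plus \<open>s - t\<close> on
      the diagonal.\<close>
    also have "\<dots> = (\<Sum>x\<in>S. t * c x + (if x = y then (s - t) * c x else 0))"
      using that by (intro sum.cong) (auto simp: diag off algebra_simps)
    also have "\<dots> = t * C + (s - t) * c y"
      using that \<open>finite S\<close> by (simp add: sum.distrib C_def sum_distrib_left)
    finally show ?thesis by simp
  qed
  \<comment> \<open>If \<open>C\<close> were zero, \<open>eq\<close> and \<open>t < s\<close> would
    force every coefficient to vanish.\<close>
  have "C \<noteq> 0"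
    using c(1) eq \<open>t < s\<close> by fastforce
  \<comment> \<open>Summing \<open>eq\<close> over \<open>S\<close> leaves only \<open>C\<close>,
    which can be cancelled.\<close>
  have "0 = (\<Sum>y\<in>S. (s - t) * c y + t * C)"
    using eq by simp
  also have "\<dots> = (s - t) * C + real (card S) * (t * C)"
    by (simp add: sum.distrib C_def sum_distrib_left)
  also have "\<dots> = (s + (real (card S) - 1) * t) * C"
    by (simp add: algebra_simps)
  finally show ?thesis using \<open>C \<noteq> 0\<close> by simp
qed

theorem lemma1:
  fixes w :: "nat \<Rightarrow> real ^ 'd" and m :: nat and s t :: real
  assumes "m \<ge> 1" and "t < s"
    and "\<And>i. i \<in> {1..m} \<Longrightarrow> w i \<bullet> w i = s"
    and "\<And>i j. i \<in> {1..m} \<Longrightarrow> j \<in> {1..m} \<Longrightarrow> i \<noteq> j \<Longrightarrow> w i \<bullet> w j = t"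
  shows "m \<le> CARD('d) + 1 \<and> (m = CARD('d) + 1 \<longrightarrow> t = - s / real CARD('d))"
proof -
  \<comment> \<open>Kept general in \<open>n\<close> so that two different sizes can be compared
    below.\<close>
  have rel: "s + (real n - 1) * t = 0" if n: "CARD('d) < n" "n \<le> m" for n
  proof -
    \<comment> \<open>A repeated vector would give \<open>s = t\<close>, so the image is a set of
      exactly \<open>n\<close> vectors.\<close>
    have "inj_on w {1..n}"
    proof (rule inj_onI, rule ccontr)
      fix i j assume ij: "i \<in> {1..n}" "j \<in> {1..n}" "w i = w j" "i \<noteq> j"
      then show False
        using assms(3)[of i] assms(4)[of i j] \<open>t < s\<close> n by simp
    qed
    then have card: "card (w ` {1..n}) = n"
      by (simp add: card_image)
    have "dependent (w ` {1..n})"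
      using n card by (intro dependent_biggerset) auto
    then have "s + (real (card (w ` {1..n})) - 1) * t = 0"
      using n by (intro dependent_equiangular[OF _ _ \<open>t < s\<close>]) (auto intro!: assms(3,4))
    then show ?thesis by (simp only: card)
  qed
  have "m \<le> CARD('d) + 1"
  proof (rule ccontr)
    assume "\<not> m \<le> CARD('d) + 1"
    then have "s + real CARD('d) * t = 0" "s + (real CARD('d) + 1) * t = 0"
      using rel[of "CARD('d) + 1"] rel[of "CARD('d) + 2"] by (simp_all add: add.commute)
    moreover from this have "t = 0"
      by (simp add: algebra_simps)
    ultimately show False using \<open>t < s\<close> by simp
  qed
  moreover have "t = - s / real CARD('d)" if "m = CARD('d) + 1"
    using rel[of m] that by (simp add: field_simps)
  ultimately show ?thesis by blast
qed

end
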